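(* Let $p$ be a prime. There exists a group $P$ of order $p^6$ such that $\mathrm{Z}(P)$ and $P/\mathrm{Z}(P)$ are elementary abelian of order $p^3$ and $\mathcal{CD}(P) = \{\mathrm{Z}(P), P\}$.
   Context: For a finite group $G$ and a subgroup $U \le G$, the Chermak-Delgado measure of $U$ in $G$ is $m_G(U) = |U|\,|C_G(U)|$. Put $m(G) = \max\{m_G(U) \mid U \le G\}$ and $\mathcal{CD}(G) = \{U \le G \mid m_G(U) = m(G)\}$, the Chermak-Delgado lattice of $G$. $\mathrm{Z}(P)$ denotes the center of $P$. *)

theory Defs
  imports "HOL-Algebra.Coset" "HOL-Computational_Algebra.Primes"
begin

definition centralizer :: "('a, 'b) monoid_scheme \<Rightarrow> 'a set \<Rightarrow> 'a set" where
  "centralizer G U = {g \<in> carrier G. \<forall>u\<in>U. g \<otimes>\<^bsub>G\<^esub> u = u \<otimes>\<^bsub>G\<^esub> g}"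

definition center :: "('a, 'b) monoid_scheme \<Rightarrow> 'a set" where
  "center G = centralizer G (carrier G)"

definition elementary_abelian :: "nat \<Rightarrow> ('a, 'b) monoid_scheme \<Rightarrow> bool" where
  "elementary_abelian p G \<longleftrightarrow>
     prime p \<and> comm_group G \<and> finite (carrier G) \<and> (\<forall>x\<in>carrier G. x [^]\<^bsub>G\<^esub> p = \<one>\<^bsub>G\<^esub>)"

definition cd_measure :: "('a, 'b) monoid_scheme \<Rightarrow> 'a set \<Rightarrow> nat" where
  "cd_measure G U = card U * card (centralizer G U)"

text \<open>The next two notions are meaningful only for finite groups, where the maximum is
  taken over a finite nonempty set.\<close>

definition max_cd_measure :: "('a, 'b) monoid_scheme \<Rightarrow> nat" where
  "max_cd_measure G = Max {cd_measure G U | U. subgroup U G}"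

definition CD_lattice :: "('a, 'b) monoid_scheme \<Rightarrow> 'a set set" where
  "CD_lattice G = {U. subgroup U G \<and> cd_measure G U = max_cd_measure G}"

end

theory Submission
  imports Defs "HOL-Algebra.Weak_Morphisms" "HOL-Library.Countable" "HOL-Number_Theory.Cong"
begin

text \<open>Take \<open>P = V \<times> V\<close> with \<open>V = (\<int>/p)\<^sup>3\<close> and a bilinear cocycle whose antisymmetrisation is
  the cross product, so that the commutator map is an isomorphism from the exterior square of
  \<open>P/Z(P)\<close> onto \<open>Z(P)\<close>; using a cocycle that is not antisymmetric makes this work for \<open>p = 2\<close> too.
  Two vectors commute iff they are parallel, hence noncentral elements have centralizers of order
  \<open>p\<^sup>4\<close>.  If neither \<open>U\<close> nor \<open>C(U)\<close> is central, both lie in such centralizers and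
  \<open>|U| |C(U)| \<le> p\<^sup>8 < p\<^sup>9 = |P| |Z(P)|\<close>.  If one of them is central, the bound \<open>|P| |Z(P)|\<close> is
  immediate, with equality only for \<open>U = P\<close> or \<open>U = Z(P)\<close>.\<close>

section \<open>Centralizers and the Chermak-Delgado lattice\<close>

lemma centralizer_subset_carrier: "centralizer G U \<subseteq> carrier G"
  by (auto simp: centralizer_def)

lemma center_subset_carrier: "center G \<subseteq> carrier G"
  by (simp add: center_def centralizer_subset_carrier)

lemma center_commute:
  assumes "x \<in> center G" "y \<in> carrier G"
  shows "x \<otimes>\<^bsub>G\<^esub> y = y \<otimes>\<^bsub>G\<^esub> x"
  using assms unfolding center_def centralizer_def by blast

lemma (in group) subgroup_centralizer:
  assumes "U \<subseteq> carrier G"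
  shows "subgroup (centralizer G U) G"
proof (rule subgroupI)
  fix a assume a: "a \<in> centralizer G U"
  have "inv a \<otimes> u = u \<otimes> inv a" if "u \<in> U" for u
  proof -
    have "a \<in> carrier G" "u \<in> carrier G" "a \<otimes> u = u \<otimes> a"
      using a that assms by (auto simp: centralizer_def)
    then show ?thesis
      by (metis inv_closed inv_solve_left inv_solve_right m_assoc m_closed)
  qed
  then show "inv a \<in> centralizer G U"
    using a by (auto simp: centralizer_def)
next
  fix a b assume ab: "a \<in> centralizer G U" "b \<in> centralizer G U"
  have "(a \<otimes> b) \<otimes> u = u \<otimes> (a \<otimes> b)" if "u \<in> U" for u
  proof -
    have "a \<in> carrier G" "b \<in> carrier G" "u \<in> carrier G" "a \<otimes> u = u \<otimes> a" "b \<otimes> u = u \<otimes> b"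
      using ab that assms by (auto simp: centralizer_def)
    then show ?thesis
      by (metis m_assoc)
  qed
  then show "a \<otimes> b \<in> centralizer G U"
    using ab by (auto simp: centralizer_def)
next
  have "\<one> \<in> centralizer G U"
    using assms by (auto simp: centralizer_def)
  then show "centralizer G U \<noteq> {}" by blast
qed (rule centralizer_subset_carrier)

lemma (in group) subgroup_center: "subgroup (center G) G"
  by (simp add: center_def subgroup_centralizer)

lemma (in group) normal_center: "center G \<lhd> G"
proof (rule normal_invI[OF subgroup_center])
  fix x h assume x: "x \<in> carrier G" and h: "h \<in> center G"
  have hG: "h \<in> carrier G" and "h \<otimes> x = x \<otimes> h"
    using x h by (auto simp: center_def centralizer_def)
  then have "x \<otimes> h \<otimes> inv x = h \<otimes> x \<otimes> inv x" by simp
  also have "\<dots> = h"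
    using x hG by (simp add: m_assoc)
  finally show "x \<otimes> h \<otimes> inv x \<in> center G" using h by simp
qed

lemma centralizer_center: "centralizer G (center G) = carrier G"
  by (auto simp: center_def centralizer_def)

text \<open>This part of the argument is independent of the concrete group. A bound on centralizers
  of single noncentral elements controls all subgroups: a noncentral \<open>x\<close> in
  \<open>U\<close> and a noncentral \<open>y\<close> centralizing \<open>U\<close> put
  \<open>U\<close> inside the centralizer of \<open>y\<close> and the centralizer of
  \<open>U\<close> inside that of \<open>x\<close>.\<close>

lemma (in group) CD_lattice_eqI:
  assumes fin: "finite (carrier G)"
    and small: "\<And>x y. x \<in> carrier G - center G \<Longrightarrow> y \<in> carrier G - center G \<Longrightarrow>
      card (centralizer G {x}) * card (centralizer G {y}) < card (carrier G) * card (center G)"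
  shows "CD_lattice G = {center G, carrier G}"
proof -
  let ?m = "card (carrier G) * card (center G)"
  have finZ: "finite (center G)"
    by (rule finite_subset[OF center_subset_carrier fin])
  have pos: "card (carrier G) > 0" "card (center G) > 0"
    using fin finZ subgroup_center subgroup.one_closed by (auto simp: card_gt_0_iff)
  have Zm: "cd_measure G (center G) = ?m"
    by (simp add: cd_measure_def centralizer_center)
  have Gm: "cd_measure G (carrier G) = ?m"
    by (simp add: cd_measure_def center_def)
  \<comment> \<open>A strict bound away from the two candidates yields both the maximum and the fact
    that nothing else attains it.\<close>
  have lt: "cd_measure G U < ?m" if U: "subgroup U G" and ne: "U \<noteq> center G" "U \<noteq> carrier G" for U
  proof -
    have sub: "U \<subseteq> carrier G" using U by (rule subgroup.subset)
    have Zsub: "center G \<subseteq> centralizer G U"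
      using sub by (auto simp: center_def centralizer_def)
    \<comment> \<open>The centralizer of \<open>U\<close> always contains the center, so it either
      equals the center or has an element outside it.\<close>
    consider (central) "U \<subseteq> center G" | (full) "centralizer G U = center G"
      | (proper) x y where "x \<in> U" "x \<notin> center G" "y \<in> centralizer G U" "y \<notin> center G"
      using Zsub by blast
    then show ?thesis
    proof cases
      case central
      then have "card U < card (center G)"
        using ne finZ by (intro psubset_card_mono) auto
      have "card (centralizer G U) \<le> card (carrier G)"
        by (intro card_mono fin centralizer_subset_carrier)
      then have "card U * card (centralizer G U) \<le> card U * card (carrier G)" by simp
      moreover have "card U * card (carrier G) < card (center G) * card (carrier G)"
        using \<open>card U < card (center G)\<close> pos by simp
      ultimately have "card U * card (centralizer G U) < card (center G) * card (carrier G)"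
        by linarith
      then show ?thesis by (simp add: cd_measure_def mult.commute)
    next
      case full
      have "card U < card (carrier G)"
        using ne sub fin by (intro psubset_card_mono) auto
      with full pos show ?thesis by (simp add: cd_measure_def)
    next
      case proper
      have xy: "x \<in> carrier G - center G" "y \<in> carrier G - center G"
        using proper sub subsetD[OF centralizer_subset_carrier proper(3)] by blast+
      have "U \<subseteq> centralizer G {y}" "centralizer G U \<subseteq> centralizer G {x}"
        using proper sub by (auto simp: centralizer_def)
      moreover have "finite (centralizer G {x})" "finite (centralizer G {y})"
        by (rule finite_subset[OF centralizer_subset_carrier fin])+
      ultimately have "card U * card (centralizer G U) \<le> card (centralizer G {y}) * card (centralizer G {x})"
        by (intro mult_le_mono card_mono)
      also have "\<dots> < ?m" using small xy by blast
      finally show ?thesis by (simp add: cd_measure_def)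
    qed
  qed
  have max: "max_cd_measure G = ?m"
    unfolding max_cd_measure_def
  proof (rule Max_eqI)
    have "{U. subgroup U G} \<subseteq> Pow (carrier G)"
      using subgroup.subset by blast
    then have "finite {U. subgroup U G}"
      by (rule finite_subset) (simp add: fin)
    then show "finite {cd_measure G U |U. subgroup U G}" by simp
    show "?m \<in> {cd_measure G U |U. subgroup U G}"
      by (intro CollectI exI[of _ "carrier G"]) (simp add: Gm subgroup_self)
    show "n \<le> ?m" if "n \<in> {cd_measure G U |U. subgroup U G}" for n
    proof -
      obtain U where "subgroup U G" "n = cd_measure G U"
        using \<open>n \<in> _\<close> by blast
      then show ?thesis
        using lt[of U] Zm Gm by (metis less_imp_le order_refl)
    qed
  qed
  show ?thesis
    unfolding CD_lattice_def max using lt Zm Gm subgroup_center subgroup_self by fastforce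
qed

section \<open>Elementary abelian center and central quotient\<close>

lemma (in group) elementary_abelian_center:
  assumes "prime p" "finite (carrier G)" "\<And>z. z \<in> center G \<Longrightarrow> z [^] p = \<one>"
  shows "elementary_abelian p (G\<lparr>carrier := center G\<rparr>)"
proof -
  have "group (G\<lparr>carrier := center G\<rparr>)"
    using subgroup_center by (rule subgroup.subgroup_is_group[OF _ is_group])
  then have "comm_group (G\<lparr>carrier := center G\<rparr>)"
    by (rule group.group_comm_groupI)
      (simp add: center_commute subsetD[OF center_subset_carrier])
  moreover have "finite (center G)"
    by (rule finite_subset[OF center_subset_carrier assms(2)])
  ultimately show ?thesis
    using assms by (auto simp: elementary_abelian_def nat_pow_consistent[symmetric])
qed

text \<open>Triviality of commutators modulo \<open>N\<close> is phrased as xy = z(yx), so that the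
  coset simply absorbs \<open>z\<close>; p-th powers are absorbed in the same way.\<close>

lemma (in group) elementary_abelian_FactGroup:
  assumes "prime p" "finite (carrier G)" "N \<lhd> G"
    and comm: "\<And>x y. x \<in> carrier G \<Longrightarrow> y \<in> carrier G \<Longrightarrow> \<exists>z\<in>N. x \<otimes> y = z \<otimes> (y \<otimes> x)"
    and pow: "\<And>x. x \<in> carrier G \<Longrightarrow> x [^] p \<in> N"
  shows "elementary_abelian p (G Mod N)"
proof -
  interpret N: normal N G by fact
  have sub: "subgroup N G" by (rule N.subgroup_axioms)
  have eq: "N #> (x \<otimes> y) = N #> (y \<otimes> x)" if "x \<in> carrier G" "y \<in> carrier G" for x y
  proof -
    obtain z where z: "z \<in> N" "x \<otimes> y = z \<otimes> (y \<otimes> x)"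
      using comm \<open>x \<in> carrier G\<close> \<open>y \<in> carrier G\<close> by blast
    then have "N #> (x \<otimes> y) = N #> z #> (y \<otimes> x)"
      using that N.subset by (simp add: coset_mult_assoc)
    also have "N #> z = N"
      using z sub N.subset by (intro coset_join2) auto
    finally show ?thesis .
  qed
  have "comm_group (G Mod N)"
    by (rule group.group_comm_groupI[OF N.factorgroup_is_group])
      (auto simp: carrier_FactGroup N.rcos_sum eq)
  moreover have "finite (carrier (G Mod N))"
    using assms by (simp add: carrier_FactGroup)
  moreover have "(N #> x) [^]\<^bsub>G Mod N\<^esub> p = N" if "x \<in> carrier G" for x
    using that pow sub by (simp add: N.FactGroup_pow coset_join2)
  ultimately show ?thesis
    using assms by (auto simp: elementary_abelian_def carrier_FactGroup)
qed

section \<open>Transport of centralizers along isomorphisms\<close>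

text \<open>Injectivity makes \<open>f\<close> reflect commutation as well as preserve it, and
  surjectivity makes every element of \<open>H\<close> an image.\<close>

lemma iso_image_centralizer:
  assumes f: "f \<in> iso G H" and U: "U \<subseteq> carrier G" and G: "group G"
  shows "centralizer H (f ` U) = f ` centralizer G U"
proof -
  interpret group G by fact
  have hom: "f (x \<otimes>\<^bsub>G\<^esub> y) = f x \<otimes>\<^bsub>H\<^esub> f y" if "x \<in> carrier G" "y \<in> carrier G" for x y
    using f that by (auto simp: iso_def hom_def)
  have inj: "inj_on f (carrier G)" and surj: "f ` carrier G = carrier H"
    using f by (auto simp: iso_def bij_betw_def)
  have "f x \<otimes>\<^bsub>H\<^esub> f u = f u \<otimes>\<^bsub>H\<^esub> f x \<longleftrightarrow> x \<otimes>\<^bsub>G\<^esub> u = u \<otimes>\<^bsub>G\<^esub> x"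
    if "x \<in> carrier G" "u \<in> carrier G" for x u
    using that by (simp add: hom[symmetric] inj_on_eq_iff[OF inj])
  then show ?thesis
    using U by (auto simp: centralizer_def surj[symmetric] subset_iff)
qed

lemma iso_image_center:
  assumes "f \<in> iso G H" "group G"
  shows "center H = f ` center G"
  using iso_image_centralizer[OF assms(1) subset_refl assms(2)] assms(1)
  by (simp add: center_def iso_def bij_betw_def)

section \<open>The group\<close>

type_synonym hexad = "int \<times> int \<times> int \<times> int \<times> int \<times> int"

text \<open>Writing v = (a, b, c) and w = (x, y, z), the product is (v, w)(v', w') = (v + v', w + w'
  + B(v, v')). The cocycle B(v, v') = (bc', ca', ab') consists of the positive terms of the cross
  product, so B(v, v') - B(v', v) = v \<times> v'. Residues modulo \<open>n\<close> are represented
  by integers from 0 to n - 1.\<close>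

definition cross_group :: "int \<Rightarrow> hexad monoid" where
  "cross_group n =
    \<lparr>carrier = {0..<n} \<times> {0..<n} \<times> {0..<n} \<times> {0..<n} \<times> {0..<n} \<times> {0..<n},
     monoid.mult = (\<lambda>(a, b, c, x, y, z) (a', b', c', x', y', z').
       ((a + a') mod n, (b + b') mod n, (c + c') mod n,
        (x + x' + b * c') mod n, (y + y' + c * a') mod n, (z + z' + a * b') mod n)),
     one = (0, 0, 0, 0, 0, 0)\<rparr>"

lemma carrier_cross_group:
  "carrier (cross_group n) = {0..<n} \<times> {0..<n} \<times> {0..<n} \<times> {0..<n} \<times> {0..<n} \<times> {0..<n}"
  by (simp add: cross_group_def)

lemma mult_cross_group:
  "(a, b, c, x, y, z) \<otimes>\<^bsub>cross_group n\<^esub> (a', b', c', x', y', z') =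
     ((a + a') mod n, (b + b') mod n, (c + c') mod n,
      (x + x' + b * c') mod n, (y + y' + c * a') mod n, (z + z' + a * b') mod n)"
  by (simp add: cross_group_def)

lemma one_cross_group: "\<one>\<^bsub>cross_group n\<^esub> = (0, 0, 0, 0, 0, 0)"
  by (simp add: cross_group_def)

text \<open>These rules strip the inner reductions from the sums that nested products in
  \<open>cross_group\<close> produce, leaving polynomial identities.\<close>

lemma mod_add_nested_simps:
  fixes s t k n :: int
  shows "(s + k * (t mod n)) mod n = (s + k * t) mod n"
    and "(s + (t mod n) * k) mod n = (s + t * k) mod n"
    and "(s mod n + t + k) mod n = (s + t + k) mod n"
    and "(s + t mod n + k) mod n = (s + t + k) mod n"
    and "(s mod n + t - k) mod n = (s + t - k) mod n"
  by (intro cong_diff[unfolded cong_def] cong_add[unfolded cong_def] cong_mult[unfolded cong_def]; simp)+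

lemmas cross_group_simps = carrier_cross_group mult_cross_group one_cross_group

text \<open>Associativity is additivity of B in each argument: both bracketings add B(v, v') + B(v,
  v'') + B(v', v'') to the central coordinates.\<close>

lemma group_cross_group:
  assumes "n > 0"
  shows "group (cross_group n)"
proof (rule groupI)
  fix u v w assume "u \<in> carrier (cross_group n)" "v \<in> carrier (cross_group n)"
    "w \<in> carrier (cross_group n)"
  then show "u \<otimes>\<^bsub>cross_group n\<^esub> v \<otimes>\<^bsub>cross_group n\<^esub> w =
      u \<otimes>\<^bsub>cross_group n\<^esub> (v \<otimes>\<^bsub>cross_group n\<^esub> w)"
    by (auto simp: cross_group_simps mod_simps mod_add_nested_simps) (simp_all add: algebra_simps)
next
  fix u assume "u \<in> carrier (cross_group n)"
  then obtain a b c x y z where "u = (a, b, c, x, y, z)"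
    by (cases u) auto
  \<comment> \<open>The left inverse has first half -v. Since B(-v, v) = -B(v, v), its second half
    must be -w + B(v, v).\<close>
  then have "((- a) mod n, (- b) mod n, (- c) mod n,
      (- x + b * c) mod n, (- y + c * a) mod n, (- z + a * b) mod n)
        \<otimes>\<^bsub>cross_group n\<^esub> u = \<one>\<^bsub>cross_group n\<^esub>"
    by (simp add: cross_group_simps mod_simps mod_add_nested_simps)
  then show "\<exists>v\<in>carrier (cross_group n). v \<otimes>\<^bsub>cross_group n\<^esub> u = \<one>\<^bsub>cross_group n\<^esub>"
    using assms by (intro bexI) (auto simp: carrier_cross_group)
qed (use assms in \<open>auto simp: cross_group_simps\<close>)

lemma order_cross_group: "card (carrier (cross_group (int p))) = p ^ 6"
  by (simp add: carrier_cross_group card_cartesian_product eval_nat_numeral)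

text \<open>The two products differ only in their cocycle terms, and equating these terms says that
  the cross product of the first halves vanishes modulo \<open>n\<close>.\<close>

lemma commute_cross_group_iff:
  "(a, b, c, x, y, z) \<otimes>\<^bsub>cross_group n\<^esub> (a', b', c', x', y', z') =
   (a', b', c', x', y', z') \<otimes>\<^bsub>cross_group n\<^esub> (a, b, c, x, y, z) \<longleftrightarrow>
     [b * c' = c * b'] (mod n) \<and> [c * a' = a * c'] (mod n) \<and> [a * b' = b * a'] (mod n)"
proof -
  have "[s + t + k = t + s + l] (mod n) \<longleftrightarrow> [k = l] (mod n)" for s t k l :: int
    by (simp add: add.commute[of s t] cong_add_lcancel)
  then have "(s + t + k) mod n = (t + s + l) mod n \<longleftrightarrow> [k = l] (mod n)" for s t k l :: int
    by (simp add: cong_def)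
  then show ?thesis
    by (simp only: mult_cross_group prod.inject add.commute[of a' a] add.commute[of b' b]
        add.commute[of c' c]) (simp add: mult.commute)
qed

lemma center_cross_group:
  assumes "n > 1"
  shows "center (cross_group n) = {0} \<times> {0} \<times> {0} \<times> {0..<n} \<times> {0..<n} \<times> {0..<n}"
    (is "_ = ?Z")
proof (intro equalityI subsetI)
  fix u assume u: "u \<in> center (cross_group n)"
  obtain a b c x y z where uc: "u = (a, b, c, x, y, z)" by (cases u) auto
  have range: "a \<in> {0..<n}" "b \<in> {0..<n}" "c \<in> {0..<n}"
    "x \<in> {0..<n}" "y \<in> {0..<n}" "z \<in> {0..<n}"
    using subsetD[OF center_subset_carrier u] by (auto simp: uc carrier_cross_group)
  have comm: "u \<otimes>\<^bsub>cross_group n\<^esub> v = v \<otimes>\<^bsub>cross_group n\<^esub> u" if "v \<in> carrier (cross_group n)" for v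
    using u that by (auto simp: center_def centralizer_def)
  \<comment> \<open>Two basis vectors suffice as tests: commuting with the first forces b and c to
    vanish, commuting with the second forces a and c to vanish.\<close>
  have "u \<otimes>\<^bsub>cross_group n\<^esub> (1, 0, 0, 0, 0, 0) = (1, 0, 0, 0, 0, 0) \<otimes>\<^bsub>cross_group n\<^esub> u"
    "u \<otimes>\<^bsub>cross_group n\<^esub> (0, 1, 0, 0, 0, 0) = (0, 1, 0, 0, 0, 0) \<otimes>\<^bsub>cross_group n\<^esub> u"
    using assms by (intro comm; simp add: carrier_cross_group)+
  then have "a mod n = 0" "b mod n = 0" "c mod n = 0"
    unfolding uc commute_cross_group_iff by (auto simp: cong_def)
  then show "u \<in> ?Z"
    using range uc by auto
next
  fix u assume "u \<in> ?Z"
  then show "u \<in> center (cross_group n)"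
    using assms by (auto simp: center_def centralizer_def carrier_cross_group commute_cross_group_iff)
qed

text \<open>The i-th multiplication by (v, w) contributes B((i - 1)v, v) = (i - 1)B(v, v), and these
  factors add up to \<open>k choose 2\<close>.\<close>

lemma pow_cross_group:
  "(a, b, c, x, y, z) [^]\<^bsub>cross_group n\<^esub> (k::nat) =
    (int k * a mod n, int k * b mod n, int k * c mod n,
     (int k * x + int (k choose 2) * (b * c)) mod n,
     (int k * y + int (k choose 2) * (c * a)) mod n,
     (int k * z + int (k choose 2) * (a * b)) mod n)"
proof (induction k)
  case 0
  show ?case by (simp add: one_cross_group numeral_2_eq_2)
next
  case (Suc k)
  have "Suc k choose 2 = k + (k choose 2)"
    by (simp add: numeral_2_eq_2)
  with Suc show ?case
    by (simp add: mult_cross_group mod_simps mod_add_nested_simps) (simp add: algebra_simps)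
qed

text \<open>The central witness is the cross product of the first halves, which is exactly the
  difference of the two cocycle terms.\<close>

lemma commutator_cross_group:
  assumes "n > 1" "u \<in> carrier (cross_group n)" "v \<in> carrier (cross_group n)"
  shows "\<exists>z\<in>center (cross_group n). u \<otimes>\<^bsub>cross_group n\<^esub> v = z \<otimes>\<^bsub>cross_group n\<^esub> (v \<otimes>\<^bsub>cross_group n\<^esub> u)"
proof -
  obtain a b c x y z where u: "u = (a, b, c, x, y, z)" by (cases u) auto
  obtain a' b' c' x' y' z' where v: "v = (a', b', c', x', y', z')" by (cases v) auto
  let ?z = "(0, 0, 0, (b * c' - b' * c) mod n, (c * a' - c' * a) mod n, (a * b' - a' * b) mod n)"
  have "u \<otimes>\<^bsub>cross_group n\<^esub> v = ?z \<otimes>\<^bsub>cross_group n\<^esub> (v \<otimes>\<^bsub>cross_group n\<^esub> u)"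
    unfolding u v by (simp add: mult_cross_group mod_simps) (simp add: algebra_simps)
  moreover have "?z \<in> center (cross_group n)"
    using assms by (simp add: center_cross_group)
  ultimately show ?thesis by blast
qed

section \<open>Centralizers of noncentral elements\<close>

lemma cong_mult_lcancel_prime:
  fixes a b c p :: int
  assumes "prime p" "a \<noteq> 0" "a \<in> {0..<p}" "b \<in> {0..<p}" "c \<in> {0..<p}" "[a * b = a * c] (mod p)"
  shows "b = c"
proof -
  have "coprime a p"
    using assms by (metis atLeastLessThan_iff coprime_commute linorder_not_le order_le_less prime_imp_coprime zdvd_imp_le)
  then have "[b = c] (mod p)"
    using assms cong_mult_lcancel by blast
  then show ?thesis
    using assms by (simp add: cong_def)
qed

text \<open>The exponent 4 counts one coordinate for a vector parallel to a fixed nonzero one, plus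
  the three unrestricted central coordinates.\<close>

lemma card_centralizer_cross_group:
  assumes p: "prime p" and u: "u \<in> carrier (cross_group (int p)) - center (cross_group (int p))"
  shows "card (centralizer (cross_group (int p)) {u}) \<le> p ^ 4"
proof -
  let ?I = "{0..<int p}"
  let ?C = "centralizer (cross_group (int p)) {u}"
  obtain a b c x y z where uc: "u = (a, b, c, x, y, z)" by (cases u) auto
  have range: "a \<in> ?I" "b \<in> ?I" "c \<in> ?I"
    and nonzero: "a \<noteq> 0 \<or> b \<noteq> 0 \<or> c \<noteq> 0"
    using u prime_gt_1_nat[OF p] by (auto simp: uc carrier_cross_group center_cross_group)
  \<comment> \<open>The congruences are oriented so that the coordinates of the fixed
    \<open>u\<close> stand on the left of each product, ready for cancellation.\<close>
  have C: "(a', b', c', x', y', z') \<in> ?C \<longleftrightarrow> (a', b', c', x', y', z') \<in> carrier (cross_group (int p)) \<and>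
      [b * c' = c * b'] (mod int p) \<and> [c * a' = a * c'] (mod int p) \<and> [a * b' = b * a'] (mod int p)"
    for a' b' c' x' y' z'
    by (auto simp: centralizer_def uc commute_cross_group_iff
        cong_sym_eq[of "b' * c"] cong_sym_eq[of "a * c'"] cong_sym_eq[of "a' * b"] mult.commute)
  note cancel = cong_mult_lcancel_prime[of "int p"]
  have coord: "card ?C \<le> p ^ 4" if "inj_on f ?C" "f ` ?C \<subseteq> ?I \<times> ?I \<times> ?I \<times> ?I"
    for f :: "hexad \<Rightarrow> int \<times> int \<times> int \<times> int"
  proof -
    have "card ?C \<le> card (?I \<times> ?I \<times> ?I \<times> ?I)"
      using that by (intro card_inj_on_le) auto
    then show ?thesis by (simp add: card_cartesian_product eval_nat_numeral)
  qed
  \<comment> \<open>A vector parallel to \<open>(a, b, c)\<close> is determined by any coordinate in which \<open>(a, b, c)\<close> is nonzero.\<close>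
  consider "a \<noteq> 0" | "b \<noteq> 0" | "c \<noteq> 0" using nonzero by blast
  then show ?thesis
  proof cases
    case 1
    have "inj_on (\<lambda>(a', b', c', r). (a', r)) ?C"
    proof (rule inj_onI)
      fix v w assume vw: "v \<in> ?C" "w \<in> ?C"
        and eq: "(case v of (a', b', c', r) \<Rightarrow> (a', r)) = (case w of (a', b', c', r) \<Rightarrow> (a', r))"
      obtain b1 c1 a' x' y' z' b2 c2
        where v: "v = (a', b1, c1, x', y', z')" and w: "w = (a', b2, c2, x', y', z')"
        using eq by (cases v; cases w) auto
      note * = vw[unfolded v w C]
      \<comment> \<open>Both sides are congruent to \<open>b * a'\<close> in the first case and to
        \<open>c * a'\<close> in the second, because \<open>v\<close> and \<open>w\<close> share the
        coordinate \<open>a'\<close>. The other two cases permute the coordinates.\<close>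
      then have "[a * b1 = a * b2] (mod int p)" "[a * c1 = a * c2] (mod int p)"
        by (meson cong_sym cong_trans)+
      with 1 * range p have "b1 = b2 \<and> c1 = c2"
        by (auto simp: carrier_cross_group intro: cancel[of a])
      then show "v = w" by (simp add: v w)
    qed
    then show ?thesis
      by (rule coord) (auto simp: C carrier_cross_group)
  next
    case 2
    have "inj_on (\<lambda>(a', b', c', r). (b', r)) ?C"
    proof (rule inj_onI)
      fix v w assume vw: "v \<in> ?C" "w \<in> ?C"
        and eq: "(case v of (a', b', c', r) \<Rightarrow> (b', r)) = (case w of (a', b', c', r) \<Rightarrow> (b', r))"
      obtain a1 c1 b' x' y' z' a2 c2
        where v: "v = (a1, b', c1, x', y', z')" and w: "w = (a2, b', c2, x', y', z')"
        using eq by (cases v; cases w) auto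
      note * = vw[unfolded v w C]
      then have "[b * a1 = b * a2] (mod int p)" "[b * c1 = b * c2] (mod int p)"
        by (meson cong_sym cong_trans)+
      with 2 * range p have "a1 = a2 \<and> c1 = c2"
        by (auto simp: carrier_cross_group intro: cancel[of b])
      then show "v = w" by (simp add: v w)
    qed
    then show ?thesis
      by (rule coord) (auto simp: C carrier_cross_group)
  next
    case 3
    have "inj_on (\<lambda>(a', b', c', r). (c', r)) ?C"
    proof (rule inj_onI)
      fix v w assume vw: "v \<in> ?C" "w \<in> ?C"
        and eq: "(case v of (a', b', c', r) \<Rightarrow> (c', r)) = (case w of (a', b', c', r) \<Rightarrow> (c', r))"
      obtain a1 b1 c' x' y' z' a2 b2
        where v: "v = (a1, b1, c', x', y', z')" and w: "w = (a2, b2, c', x', y', z')"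
        using eq by (cases v; cases w) auto
      note * = vw[unfolded v w C]
      then have "[c * a1 = c * a2] (mod int p)" "[c * b1 = c * b2] (mod int p)"
        by (meson cong_sym cong_trans)+
      with 3 * range p have "a1 = a2 \<and> b1 = b2"
        by (auto simp: carrier_cross_group intro: cancel[of c])
      then show "v = w" by (simp add: v w)
    qed
    then show ?thesis
      by (rule coord) (auto simp: C carrier_cross_group)
  qed
qed

section \<open>Transfer to the natural numbers and conclusion\<close>

theorem proposition2p3:
  fixes p :: nat
  assumes "prime p"
  shows "\<exists>P :: nat monoid. Group.group P \<and> order P = p ^ 6 \<and>
           elementary_abelian p (P\<lparr>carrier := center P\<rparr>) \<and>
           order (P\<lparr>carrier := center P\<rparr>) = p ^ 3 \<and>
           elementary_abelian p (P Mod center P) \<and>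
           order (P Mod center P) = p ^ 3 \<and>
           CD_lattice P = {center P, carrier P}"
proof -
  define G where "G = cross_group (int p)"
  \<comment> \<open>Sextuples of integers are countable, so \<open>to_nat\<close> is injective and
    yields an isomorphic copy of \<open>G\<close> on natural numbers.\<close>
  define f where "f = (to_nat :: hexad \<Rightarrow> nat)"
  define P where "P = image_group f G"
  have p1: "p > 1" using assms by (rule prime_gt_1_nat)
  interpret G: group G
    using p1 by (simp add: G_def group_cross_group)
  have inj: "inj_on f A" for A
    by (simp add: f_def)
  interpret P: group P
    unfolding P_def by (rule G.inj_imp_image_group_is_group[OF inj])
  have iso: "f \<in> iso G P"
    unfolding P_def by (rule inj_imp_image_group_iso[OF inj])
  then have hom: "f \<in> hom G P" by (simp add: iso_def)
  interpret f: group_hom G P f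
    by unfold_locales (rule hom)
  have carrier: "carrier P = f ` carrier G"
    by (simp add: P_def image_group_carrier)
  have center: "center P = f ` center G"
    by (rule iso_image_center[OF iso G.is_group])
  have cardP: "card (carrier P) = p ^ 6"
    using order_cross_group by (simp add: carrier card_image[OF inj] G_def)
  have finP: "finite (carrier P)"
    using cardP p1 by (intro card_ge_0_finite) simp
  have cardZ: "card (center P) = p ^ 3"
    using p1 by (simp add: center card_image[OF inj] G_def center_cross_group
        card_cartesian_product eval_nat_numeral)
  have comm: "\<exists>z\<in>center P. x \<otimes>\<^bsub>P\<^esub> y = z \<otimes>\<^bsub>P\<^esub> (y \<otimes>\<^bsub>P\<^esub> x)"
    if "x \<in> carrier P" "y \<in> carrier P" for x y
  proof -
    obtain u v where uv: "u \<in> carrier G" "v \<in> carrier G" "x = f u" "y = f v"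
      using \<open>x \<in> carrier P\<close> \<open>y \<in> carrier P\<close> by (auto simp: carrier)
    then obtain z where z: "z \<in> center G" "u \<otimes>\<^bsub>G\<^esub> v = z \<otimes>\<^bsub>G\<^esub> (v \<otimes>\<^bsub>G\<^esub> u)"
      using commutator_cross_group[of "int p" u v] p1 unfolding G_def by auto
    have "z \<in> carrier G" by (rule subsetD[OF center_subset_carrier z(1)])
    then have "x \<otimes>\<^bsub>P\<^esub> y = f z \<otimes>\<^bsub>P\<^esub> (y \<otimes>\<^bsub>P\<^esub> x)"
      using uv arg_cong[OF z(2), of f] by simp
    with z show ?thesis by (auto simp: center)
  qed
  have pow: "x [^]\<^bsub>P\<^esub> p \<in> center P" if "x \<in> carrier P" for x
  proof -
    obtain u where u: "u \<in> carrier G" "x = f u"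
      using \<open>x \<in> carrier P\<close> by (auto simp: carrier)
    \<comment> \<open>The first half of the power is p times v, hence zero. For p = 2 the second
      half can survive because \<open>2 choose 2\<close> is 1, so only centrality is
      claimed.\<close>
    have "u [^]\<^bsub>G\<^esub> p \<in> center G"
      using u p1 by (cases u) (auto simp: G_def pow_cross_group center_cross_group)
    with u show ?thesis by (simp add: center f.hom_nat_pow[symmetric])
  qed
  have powZ: "x [^]\<^bsub>P\<^esub> p = \<one>\<^bsub>P\<^esub>" if "x \<in> center P" for x
  proof -
    obtain u where u: "u \<in> center G" "x = f u"
      using \<open>x \<in> center P\<close> by (auto simp: center)
    then have uG: "u \<in> carrier G" by (auto intro: subsetD[OF center_subset_carrier])
    \<comment> \<open>For central \<open>u\<close> the first half is zero, so the binomial terms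
      disappear and only multiples of p remain.\<close>
    have "u [^]\<^bsub>G\<^esub> p = \<one>\<^bsub>G\<^esub>"
      using u uG p1 by (cases u) (auto simp: G_def pow_cross_group center_cross_group one_cross_group)
    with u uG show ?thesis by (simp add: f.hom_nat_pow[symmetric])
  qed
  have cent: "card (centralizer P {x}) \<le> p ^ 4" if "x \<in> carrier P - center P" for x
  proof -
    obtain u where u: "u \<in> carrier G - center G" "x = f u"
      using \<open>x \<in> carrier P - center P\<close> unfolding carrier center by blast
    have "centralizer P {x} = f ` centralizer G {u}"
      using iso_image_centralizer[OF iso _ G.is_group, of "{u}"] u by simp
    then show ?thesis
      using card_centralizer_cross_group[OF assms] u by (simp add: card_image[OF inj] G_def)
  qed
  have CD: "CD_lattice P = {center P, carrier P}"
  proof (rule P.CD_lattice_eqI[OF finP])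
    fix x y assume "x \<in> carrier P - center P" "y \<in> carrier P - center P"
    then have "card (centralizer P {x}) * card (centralizer P {y}) \<le> p ^ 4 * p ^ 4"
      by (intro mult_le_mono cent)
    also have "\<dots> = p ^ 8"
      by (simp flip: power_add)
    also have "\<dots> < p ^ 9"
      using p1 by (intro power_strict_increasing) auto
    also have "\<dots> = card (carrier P) * card (center P)"
      by (simp add: cardP cardZ flip: power_add)
    finally show "card (centralizer P {x}) * card (centralizer P {y}) <
      card (carrier P) * card (center P)" .
  qed
  \<comment> \<open>Lagrange's theorem, with the group order p^6 split as p^3 times p^3 so that one
    factor cancels.\<close>
  have "card (rcosets\<^bsub>P\<^esub> (center P)) * p ^ 3 = p ^ 3 * p ^ 3"
    using P.lagrange[OF P.subgroup_center] cardP cardZ by (simp add: order_def flip: power_add)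
  then have "card (rcosets\<^bsub>P\<^esub> (center P)) = p ^ 3"
    by (subst (asm) mult_right_cancel) (use p1 in auto)
  then have "order (P Mod center P) = p ^ 3"
    by (simp add: order_def FactGroup_def)
  then show ?thesis
    using P.is_group cardP cardZ CD assms finP powZ comm pow
      P.elementary_abelian_center P.elementary_abelian_FactGroup[OF _ _ P.normal_center]
    by (intro exI[of _ P]) (simp add: order_def)
qed

end
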